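(* Let $\alpha>1$ be a real number and, for $x\in(0,1]$, let $(d_i(x))_{i\ge 1}$ denote the digit sequence of the $\alpha$-expansion of $x$. For $\beta>1$ set \[ M_{\beta}=\Big\{x\in(0,1] : \lim_{k\to\infty}\frac{1}{k}\sum_{i=1}^{k}d_{i}(x)=\beta\Big\}. \] Then for all $\beta>1$ \[ \dim_{H}M_{\beta}=\frac{(1-\beta)\log(\beta-1)+\beta \log(\beta)}{-\log(\alpha-1)+\beta \log(\alpha)}, \] where $\dim_H$ denotes Hausdorff dimension.
   Context: $\mathbb{N}=\{1,2,3,\dots\}$. Let $\alpha>1$ be real. It is known that every $x\in(0,1]$ can be uniquely written in the form \[ x=\sum_{i=1}^{\infty}(\alpha-1)^{i-1}\alpha^{-(d_{1}(x)+\dots+d_{i}(x))} \] with $(d_i(x))_{i\ge1}\in\mathbb{N}^{\mathbb{N}}$, and conversely every sequence in $\mathbb{N}^{\mathbb{N}}$ defines a point of $(0,1]$ in this way. This is called the $\alpha$-expansion of $x$, and the $d_i(x)$ are its digits. *)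

theory Defs
  imports "HOL-Analysis.Analysis"
begin

(* The term diam(U)^s of the Hausdorff sums, with the conventions
   diam({})^s = 0 and 0^0 = 1 for nonempty sets.  The second one is explicit because
   0 powr 0 = 0 in HOL; it makes the 0-dimensional measure the counting measure. *)
definition diam_power :: "real \<Rightarrow> 'a::metric_space set \<Rightarrow> ennreal" where
  "diam_power s U =
     (if U = {} then 0 else if s = 0 then 1 else ennreal (diameter U powr s))"

(* Boundedness is required because the real-valued diameter is
   only meaningful for bounded sets.  Finite covers are included, as U i may be empty. *)
definition delta_covers :: "real \<Rightarrow> 'a::metric_space set \<Rightarrow> (nat \<Rightarrow> 'a set) set" where
  "delta_covers \<delta> A =
     {U. A \<subseteq> (\<Union>i. U i) \<and> (\<forall>i. bounded (U i) \<and> diameter (U i) \<le> \<delta>)}"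

definition hausdorff_premeasure :: "real \<Rightarrow> real \<Rightarrow> 'a::metric_space set \<Rightarrow> ennreal" where
  "hausdorff_premeasure s \<delta> A = (INF U\<in>delta_covers \<delta> A. \<Sum>i. diam_power s (U i))"

definition hausdorff_measure :: "real \<Rightarrow> 'a::metric_space set \<Rightarrow> ennreal" where
  "hausdorff_measure s A = (SUP \<delta>\<in>{0<..}. hausdorff_premeasure s \<delta> A)"

definition hausdorff_dim :: "'a::metric_space set \<Rightarrow> ereal" where
  "hausdorff_dim A = Inf {ereal s | s. 0 \<le> s \<and> hausdorff_measure s A = 0}"

(* Sequences are indexed from 0: d i is the mathematical digit d_(i+1), so that the factor
   (\<alpha> - 1)^(i-1) becomes (\<alpha> - 1)^i and d_1 + ... + d_i becomes the sum over j \<le> i. *)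
definition is_alpha_expansion :: "real \<Rightarrow> real \<Rightarrow> (nat \<Rightarrow> nat) \<Rightarrow> bool" where
  "is_alpha_expansion \<alpha> x d \<longleftrightarrow>
     (\<forall>i. 1 \<le> d i) \<and> (\<lambda>i. (\<alpha> - 1) ^ i / \<alpha> ^ (\<Sum>j\<le>i. d j)) sums x"

(* Meaningful for \<alpha> > 1 and x in (0,1], where the expansion exists and is unique. *)
definition alpha_digits :: "real \<Rightarrow> real \<Rightarrow> nat \<Rightarrow> nat" where
  "alpha_digits \<alpha> x = (THE d. is_alpha_expansion \<alpha> x d)"

definition digit_mean_set :: "real \<Rightarrow> real \<Rightarrow> real set" where
  "digit_mean_set \<alpha> \<beta> =
     {x \<in> {0<..1}. (\<lambda>k. (1 / real k) * (\<Sum>i<k. real (alpha_digits \<alpha> x i))) \<longlonglongrightarrow> \<beta>}"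

end

theory Submission
  imports Defs "HOL-Probability.Infinite_Product_Measure" "HOL-Probability.Probability_Mass_Function"
begin

text \<open>
  Fixing the first \<open>k\<close> digits of the \<open>\<alpha>\<close>-expansion confines \<open>x\<close> to a half-open interval of
  length \<open>(\<alpha> - 1)^k / \<alpha>^S\<close>, where \<open>S\<close> is the sum of these digits. Choose the digits
  independently, each with the geometric distribution of mean \<open>\<beta>\<close>. This gives the same interval
  the mass \<open>(\<beta> - 1)^(S - k) / \<beta>^S\<close>. Both quantities depend on \<open>k\<close> and \<open>S\<close> only, so at every
  point with digit mean \<open>\<beta>\<close>, where \<open>S / k\<close> tends to \<open>\<beta>\<close>, the length decays like
  \<open>exp (- lyapunov * k)\<close> and the mass like \<open>exp (- entropy * k)\<close>. The dimension is the ratio of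
  the two exponents, for the numerator and the denominator of the formula are this entropy and this
  Lyapunov exponent.

  For \<open>t\<close> above the ratio, every point of the set lies in intervals of all large levels \<open>k\<close> whose
  length to the power \<open>t\<close> is at most \<open>exp (- \<epsilon> * k)\<close> times their mass. Since the masses of one
  level add up to at most one, these intervals form covers with arbitrarily small Hausdorff sums
  (\<open>hausdorff_measure_eq_0\<close>).

  For \<open>t\<close> below the ratio, the digit sequences for which the mass of each interval is at most a
  constant times the \<open>t\<close>-th power of the length of the \<^emph>\<open>next\<close> interval have positive probability for
  some constant, by the strong law of large numbers (\<open>AE_digit_mean\<close>). Stop each of them
  at an interval that is longer than \<open>\<delta>\<close> while the next one is not. A set of diameter \<open>\<delta>\<close> then meets
  intervals from at most two nested families; so it captures mass at most a constant times \<open>\<delta>\<close> to the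
  power \<open>t\<close> (\<open>frostman_cover\<close>), and the mass distribution principle applies
  (\<open>hausdorff_measure_neq_0\<close>). Comparing with the next interval absorbs the unbounded ratio of the
  lengths of consecutive intervals. All probabilities are taken on the space of digit sequences, where
  an interval becomes the cylinder of sequences with a given prefix.
\<close>

section \<open>Coding of points by digit sequences\<close>

text \<open>
  A digit sequence is represented by \<open>\<omega>\<close> with \<open>Suc (\<omega> i)\<close> as its digits. All sequences of natural
  numbers are then admissible, and \<open>\<omega> i\<close> has the usual geometric distribution on the natural numbers.
\<close>

definition digit_sum :: "(nat \<Rightarrow> nat) \<Rightarrow> nat \<Rightarrow> real" where
  "digit_sum \<omega> k = real (\<Sum>i<k. Suc (\<omega> i))"

definition has_digit_mean :: "real \<Rightarrow> (nat \<Rightarrow> nat) \<Rightarrow> bool" where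
  "has_digit_mean \<beta> \<omega> \<longleftrightarrow> (\<lambda>k. digit_sum \<omega> k / real k) \<longlonglongrightarrow> \<beta>"

locale alpha_coding =
  fixes \<alpha> :: real
  assumes alpha_gt_1: "1 < \<alpha>"
begin

text \<open>
  Prefixing the digit \<open>Suc n\<close> acts on points as the affine map with slope \<open>ratio n\<close> and value
  \<open>1 / \<alpha>^Suc n\<close> at zero. Thus \<open>len \<omega> k\<close> and \<open>left \<omega> k\<close> are the slope and the value at zero of the
  composition of the first \<open>k\<close> of these maps.
\<close>

definition ratio :: "nat \<Rightarrow> real" where
  "ratio n = (\<alpha> - 1) / \<alpha> ^ Suc n"

definition len :: "(nat \<Rightarrow> nat) \<Rightarrow> nat \<Rightarrow> real" where
  "len \<omega> k = (\<Prod>i<k. ratio (\<omega> i))"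

definition left :: "(nat \<Rightarrow> nat) \<Rightarrow> nat \<Rightarrow> real" where
  "left \<omega> k = (\<Sum>i<k. len \<omega> i / \<alpha> ^ Suc (\<omega> i))"

definition point :: "(nat \<Rightarrow> nat) \<Rightarrow> real" where
  "point \<omega> = (\<Sum>i. len \<omega> i / \<alpha> ^ Suc (\<omega> i))"

lemma ratio_pos: "0 < ratio n"
  using alpha_gt_1 by (simp add: ratio_def)

lemma ratio_le: "ratio n \<le> (\<alpha> - 1) / \<alpha>"
proof -
  have "\<alpha> ^ 1 \<le> \<alpha> ^ Suc n"
    using alpha_gt_1 by (intro power_increasing) auto
  then show ?thesis
    unfolding ratio_def using alpha_gt_1 by (intro divide_left_mono) auto
qed

lemma len_0 [simp]: "len \<omega> 0 = 1"
  by (simp add: len_def)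

lemma len_Suc: "len \<omega> (Suc k) = len \<omega> k * ratio (\<omega> k)"
  by (simp add: len_def)

lemma len_pos: "0 < len \<omega> k"
  by (simp add: len_def prod_pos ratio_pos)

lemma len_le: "len \<omega> k \<le> ((\<alpha> - 1) / \<alpha>) ^ k"
proof -
  have "len \<omega> k \<le> (\<Prod>i<k. (\<alpha> - 1) / \<alpha>)"
    unfolding len_def by (intro prod_mono conjI ratio_le less_imp_le ratio_pos)
  then show ?thesis by simp
qed

lemma contraction_LIMSEQ: "(\<lambda>k. ((\<alpha> - 1) / \<alpha>) ^ k) \<longlonglongrightarrow> 0"
  using alpha_gt_1 by (intro LIMSEQ_realpow_zero) auto

lemma len_LIMSEQ: "len \<omega> \<longlonglongrightarrow> 0"
  by (rule tendsto_sandwich[OF _ _ tendsto_const contraction_LIMSEQ])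
     (auto simp: len_le less_imp_le[OF len_pos])

lemma len_eq: "len \<omega> k = (\<alpha> - 1) ^ k / \<alpha> ^ (\<Sum>i<k. Suc (\<omega> i))"
  by (simp add: len_def ratio_def prod_dividef power_sum)

lemma len_cong: "(\<And>i. i < k \<Longrightarrow> \<omega> i = \<omega>' i) \<Longrightarrow> len \<omega> k = len \<omega>' k"
  by (simp add: len_def)

lemma left_cong: "(\<And>i. i < k \<Longrightarrow> \<omega> i = \<omega>' i) \<Longrightarrow> left \<omega> k = left \<omega>' k"
  unfolding left_def by (intro sum.cong arg_cong2[where f="(/)"] len_cong) auto

lemma summand_le: "len \<omega> i / \<alpha> ^ Suc (\<omega> i) \<le> ((\<alpha> - 1) / \<alpha>) ^ i / \<alpha>"
proof -
  have "\<alpha> ^ 1 \<le> \<alpha> ^ Suc (\<omega> i)"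
    using alpha_gt_1 by (intro power_increasing) auto
  then show ?thesis
    using alpha_gt_1 len_le by (intro frac_le) auto
qed

text \<open>
  The expansion with all digits equal to one: it is the largest one and represents the point \<open>1\<close>.
\<close>

lemma dominating_sums: "(\<lambda>i. ((\<alpha> - 1) / \<alpha>) ^ i / \<alpha>) sums 1"
proof -
  have "(\<lambda>i. ((\<alpha> - 1) / \<alpha>) ^ i / \<alpha>) sums ((1 / (1 - (\<alpha> - 1) / \<alpha>)) / \<alpha>)"
    using alpha_gt_1 by (intro sums_divide geometric_sums) auto
  also have "(1 / (1 - (\<alpha> - 1) / \<alpha>)) / \<alpha> = 1"
    using alpha_gt_1 by (simp add: field_simps)
  finally show ?thesis .
qed

lemma summand_pos: "0 < len \<omega> i / \<alpha> ^ Suc (\<omega> i)"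
  using alpha_gt_1 by (simp add: len_pos)

lemma summable_summand: "summable (\<lambda>i. len \<omega> i / \<alpha> ^ Suc (\<omega> i))"
proof (rule summable_comparison_test')
  show "summable (\<lambda>i. ((\<alpha> - 1) / \<alpha>) ^ i / \<alpha>)"
    using dominating_sums by (rule sums_summable)
  show "norm (len \<omega> n / \<alpha> ^ Suc (\<omega> n)) \<le> ((\<alpha> - 1) / \<alpha>) ^ n / \<alpha>" for n
    using summand_le[of \<omega> n] summand_pos[of \<omega> n] by simp
qed

lemma point_bounds: "0 < point \<omega>" "point \<omega> \<le> 1"
proof -
  show "0 < point \<omega>"
    unfolding point_def by (rule suminf_pos[OF summable_summand summand_pos])
  have "point \<omega> \<le> (\<Sum>i. ((\<alpha> - 1) / \<alpha>) ^ i / \<alpha>)"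
    unfolding point_def
    by (intro suminf_le summand_le summable_summand sums_summable[OF dominating_sums])
  then show "point \<omega> \<le> 1"
    using sums_unique[OF dominating_sums] by simp
qed

lemma left_LIMSEQ: "left \<omega> \<longlonglongrightarrow> point \<omega>"
  using summable_LIMSEQ[OF summable_summand] by (simp add: left_def[abs_def] point_def)

text \<open>
  Self-similarity: the tail of the sequence is again the code of a point, placed by the affine map of
  the first \<open>k\<close> digits.
\<close>

lemma point_split: "point \<omega> = left \<omega> k + len \<omega> k * point (\<lambda>i. \<omega> (i + k))"
proof -
  have len_add: "len \<omega> (i + k) = len \<omega> k * len (\<lambda>i. \<omega> (i + k)) i" for i
    by (induction i) (simp_all add: len_Suc)
  have "point \<omega> = left \<omega> k + (\<Sum>i. len \<omega> (i + k) / \<alpha> ^ Suc (\<omega> (i + k)))"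
    unfolding point_def left_def
    by (subst suminf_split_initial_segment[OF summable_summand, of _ k]) simp
  also have "(\<Sum>i. len \<omega> (i + k) / \<alpha> ^ Suc (\<omega> (i + k)))
      = (\<Sum>i. len \<omega> k * (len (\<lambda>i. \<omega> (i + k)) i / \<alpha> ^ Suc (\<omega> (i + k))))"
    by (simp add: len_add)
  also have "\<dots> = len \<omega> k * point (\<lambda>i. \<omega> (i + k))"
    unfolding point_def by (rule suminf_mult[OF summable_summand])
  finally show ?thesis .
qed

text \<open>
  The first digit is determined by the position of the point among the powers of \<open>1 / \<alpha>\<close>, because
  the half-open intervals between consecutive powers are disjoint.
\<close>

lemma first_digit_bounds:
  "1 / \<alpha> ^ Suc (\<omega> 0) < point \<omega>" "point \<omega> \<le> 1 / \<alpha> ^ \<omega> 0"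
proof -
  define y where "y = point (\<lambda>i. \<omega> (i + 1))"
  have split: "point \<omega> = (1 + (\<alpha> - 1) * y) / \<alpha> ^ Suc (\<omega> 0)"
    using point_split[of \<omega> 1]
    by (simp add: left_def len_Suc ratio_def add_divide_distrib y_def)
  have "0 < y" "y \<le> 1"
    by (simp_all only: y_def point_bounds)
  then have "0 < (\<alpha> - 1) * y" "(\<alpha> - 1) * y \<le> \<alpha> - 1"
    using alpha_gt_1 by (auto intro: mult_left_le)
  then show "1 / \<alpha> ^ Suc (\<omega> 0) < point \<omega>"
    unfolding split using alpha_gt_1 by (intro divide_strict_right_mono) auto
  have "1 + (\<alpha> - 1) * y \<le> \<alpha>"
    using \<open>(\<alpha> - 1) * y \<le> \<alpha> - 1\<close> by linarith
  then have "point \<omega> \<le> \<alpha> / \<alpha> ^ Suc (\<omega> 0)"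
    unfolding split by (rule divide_right_mono) (use alpha_gt_1 in simp)
  then show "point \<omega> \<le> 1 / \<alpha> ^ \<omega> 0"
    using alpha_gt_1 by simp
qed

lemma inj_point: "inj point"
proof (rule injI)
  have first: "\<omega> 0 \<le> \<omega>' 0" if "point \<omega> = point \<omega>'" for \<omega> \<omega>'
  proof (rule ccontr)
    assume "\<not> ?thesis"
    then have "\<alpha> ^ Suc (\<omega>' 0) \<le> \<alpha> ^ \<omega> 0"
      using alpha_gt_1 by (intro power_increasing) auto
    then have "1 / \<alpha> ^ \<omega> 0 \<le> 1 / \<alpha> ^ Suc (\<omega>' 0)"
      using alpha_gt_1 by (intro divide_left_mono) auto
    then show False
      using first_digit_bounds(2)[of \<omega>] first_digit_bounds(1)[of \<omega>'] that by linarith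
  qed
  have "\<omega> k = \<omega>' k" if "point \<omega> = point \<omega>'" for \<omega> \<omega>' k
    using that
  proof (induction k arbitrary: \<omega> \<omega>')
    case 0
    then show ?case using first[of \<omega> \<omega>'] first[of \<omega>' \<omega>] by simp
  next
    case (Suc k)
    have eq: "\<omega> 0 = \<omega>' 0"
      using first[of \<omega> \<omega>'] first[of \<omega>' \<omega>] Suc.prems by simp
    then have "left \<omega> 1 = left \<omega>' 1" "len \<omega> 1 = len \<omega>' 1"
      by (simp_all add: left_def len_def)
    then have "point (\<lambda>i. \<omega> (i + 1)) = point (\<lambda>i. \<omega>' (i + 1))"
      using point_split[of \<omega> 1] point_split[of \<omega>' 1] len_pos[of \<omega>' 1] Suc.prems by simp
    from Suc.IH[OF this] show ?case by simp
  qed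
  then show "\<omega> = \<omega>'" if "point \<omega> = point \<omega>'" for \<omega> \<omega>'
    using that by blast
qed

text \<open>
  One step of the greedy algorithm.
\<close>

lemma first_step_exists:
  assumes "0 < x" "x \<le> 1"
  shows "\<exists>n y. 0 < y \<and> y \<le> 1 \<and> x = 1 / \<alpha> ^ Suc n + ratio n * y"
proof -
  have "(\<lambda>n. 1 / \<alpha> ^ Suc n) \<longlonglongrightarrow> 0"
    using LIMSEQ_realpow_zero[of "1 / \<alpha>"] alpha_gt_1
    by (intro LIMSEQ_Suc) (simp add: power_one_over)
  then have "eventually (\<lambda>n. 1 / \<alpha> ^ Suc n < x) sequentially"
    using \<open>0 < x\<close> by (rule order_tendstoD)
  then have ex: "\<exists>n. 1 / \<alpha> ^ Suc n < x"
    by (auto simp: eventually_sequentially)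
  define n where "n = (LEAST n. 1 / \<alpha> ^ Suc n < x)"
  have lower: "1 / \<alpha> ^ Suc n < x"
    unfolding n_def using ex by (rule LeastI_ex)
  have upper: "x \<le> 1 / \<alpha> ^ n"
  proof (cases n)
    case (Suc m)
    then have "\<not> 1 / \<alpha> ^ Suc m < x"
      using not_less_Least[of m "\<lambda>n. 1 / \<alpha> ^ Suc n < x"] by (simp add: n_def)
    then show ?thesis using Suc by simp
  qed (use \<open>x \<le> 1\<close> in simp)
  define y where "y = (\<alpha> ^ Suc n * x - 1) / (\<alpha> - 1)"
  have "0 < y"
    using lower alpha_gt_1 by (simp add: y_def field_simps)
  moreover have "y \<le> 1"
    using upper alpha_gt_1 by (simp add: y_def field_simps)
  moreover have "x = 1 / \<alpha> ^ Suc n + ratio n * y"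
    using alpha_gt_1 by (simp add: y_def ratio_def field_simps)
  ultimately show ?thesis by blast
qed

text \<open>
  Iterating the greedy step leaves a remainder \<open>len \<omega> k * y\<close> with \<open>y\<close> in the unit interval, which
  vanishes in the limit.
\<close>

lemma point_surj:
  assumes "0 < x" "x \<le> 1"
  obtains \<omega> where "point \<omega> = x"
proof -
  have "\<forall>x\<in>{0<..1}. \<exists>n y. y \<in> {0<..1} \<and> x = 1 / \<alpha> ^ Suc n + ratio n * y"
    using first_step_exists by fastforce
  then obtain dig nxt where step:
    "\<And>x. x \<in> {0<..1} \<Longrightarrow> nxt x \<in> {0<..1} \<and> x = 1 / \<alpha> ^ Suc (dig x) + ratio (dig x) * nxt x"
    by metis
  define \<omega> where "\<omega> i = dig ((nxt ^^ i) x)" for i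
  have orbit: "(nxt ^^ k) x \<in> {0<..1}" for k
    using assms step by (induction k) auto
  have expand: "x = left \<omega> k + len \<omega> k * (nxt ^^ k) x" for k
  proof (induction k)
    case 0
    then show ?case by (simp add: left_def)
  next
    case (Suc k)
    have "(nxt ^^ k) x = 1 / \<alpha> ^ Suc (\<omega> k) + ratio (\<omega> k) * (nxt ^^ Suc k) x"
      using step[OF orbit[of k]] by (simp add: \<omega>_def)
    then have "left \<omega> k + len \<omega> k * (nxt ^^ k) x
      = left \<omega> k + len \<omega> k * (1 / \<alpha> ^ Suc (\<omega> k) + ratio (\<omega> k) * (nxt ^^ Suc k) x)"
      by (simp only:)
    also have "\<dots> = left \<omega> (Suc k) + len \<omega> (Suc k) * (nxt ^^ Suc k) x"
      by (simp add: left_def len_Suc distrib_left)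
    finally have "left \<omega> k + len \<omega> k * (nxt ^^ k) x
      = left \<omega> (Suc k) + len \<omega> (Suc k) * (nxt ^^ Suc k) x" .
    then show ?case using Suc.IH by simp
  qed
  have "(\<lambda>k. len \<omega> k * (nxt ^^ k) x) \<longlonglongrightarrow> 0"
  proof (rule tendsto_sandwich[OF _ _ tendsto_const len_LIMSEQ])
    show "\<forall>\<^sub>F k in sequentially. 0 \<le> len \<omega> k * (nxt ^^ k) x"
      using orbit by (intro always_eventually allI mult_nonneg_nonneg less_imp_le[OF len_pos]) (simp add: less_imp_le)
    show "\<forall>\<^sub>F k in sequentially. len \<omega> k * (nxt ^^ k) x \<le> len \<omega> k"
      using orbit by (intro always_eventually allI mult_left_le less_imp_le[OF len_pos]) simp
  qed
  then have "(\<lambda>k. left \<omega> k + len \<omega> k * (nxt ^^ k) x) \<longlonglongrightarrow> point \<omega> + 0"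
    by (intro tendsto_add left_LIMSEQ)
  then have "(\<lambda>k. x) \<longlonglongrightarrow> point \<omega>"
    by (simp flip: expand)
  then have "point \<omega> = x"
    by (simp add: LIMSEQ_const_iff)
  then show thesis by (rule that)
qed

definition cyl_interval :: "(nat \<Rightarrow> nat) \<Rightarrow> nat \<Rightarrow> real set" where
  "cyl_interval \<omega> k = {left \<omega> k <.. left \<omega> k + len \<omega> k}"

lemma cyl_interval_cong:
  "(\<And>i. i < k \<Longrightarrow> \<omega> i = \<omega>' i) \<Longrightarrow> cyl_interval \<omega> k = cyl_interval \<omega>' k"
  using left_cong[of k \<omega> \<omega>'] len_cong[of k \<omega> \<omega>'] by (simp add: cyl_interval_def)

lemma point_in_cyl_interval: "point \<omega> \<in> cyl_interval \<omega> k"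
proof -
  let ?y = "point (\<lambda>i. \<omega> (i + k))"
  have "0 < len \<omega> k * ?y" "len \<omega> k * ?y \<le> len \<omega> k"
    using len_pos[of \<omega> k] point_bounds[of "\<lambda>i. \<omega> (i + k)"] by (auto intro: mult_left_le)
  then show ?thesis
    unfolding cyl_interval_def by (subst point_split[of _ k]) auto
qed

text \<open>
  Rescaling an interval of level \<open>k\<close> to the unit interval and coding the rescaled point provides the
  digits after the first \<open>k\<close>. With injectivity of the coding this makes two such intervals either
  nested or disjoint.
\<close>

lemma mem_cyl_intervalE:
  assumes "y \<in> cyl_interval \<omega> k"
  obtains \<omega>' where "point \<omega>' = y" "\<And>i. i < k \<Longrightarrow> \<omega>' i = \<omega> i"
proof -
  define z where "z = (y - left \<omega> k) / len \<omega> k"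
  have "0 < z" "z \<le> 1"
    using assms len_pos[of \<omega> k] by (auto simp: z_def cyl_interval_def)
  then obtain \<eta> where \<eta>: "point \<eta> = z"
    by (rule point_surj)
  define \<omega>' where "\<omega>' i = (if i < k then \<omega> i else \<eta> (i - k))" for i
  have "point \<omega>' = left \<omega> k + len \<omega> k * z"
    using point_split[of \<omega>' k] left_cong[of k \<omega>' \<omega>] len_cong[of k \<omega>' \<omega>] \<eta>
    by (simp add: \<omega>'_def)
  also have "\<dots> = y"
    using len_pos[of \<omega> k] by (simp add: z_def)
  finally show thesis
    by (rule that) (simp add: \<omega>'_def)
qed

lemma diameter_cyl_interval: "diameter (cyl_interval \<omega> k) = len \<omega> k"
proof -
  have "{left \<omega> k <.. left \<omega> k + len \<omega> k} \<noteq> {}"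
    using len_pos[of \<omega> k] by simp
  then have "diameter (closure {left \<omega> k <.. left \<omega> k + len \<omega> k}) = len \<omega> k"
    using len_pos[of \<omega> k] by simp
  then show ?thesis
    by (simp add: cyl_interval_def diameter_closure)
qed

lemma diam_power_cyl_interval:
  "t \<noteq> 0 \<Longrightarrow> diam_power t (cyl_interval \<omega> k) = ennreal (len \<omega> k powr t)"
  using point_in_cyl_interval[of \<omega> k]
  by (auto simp: diam_power_def diameter_cyl_interval)

lemma is_alpha_expansion_iff:
  "is_alpha_expansion \<alpha> x d \<longleftrightarrow> (\<exists>\<omega>. d = (\<lambda>i. Suc (\<omega> i)) \<and> x = point \<omega>)"
proof -
  have term_eq: "(\<alpha> - 1) ^ i / \<alpha> ^ (\<Sum>j\<le>i. Suc (\<omega> j)) = len \<omega> i / \<alpha> ^ Suc (\<omega> i)" for \<omega> i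
    unfolding len_eq by (simp add: power_add lessThan_Suc_atMost[symmetric] mult_ac)
  have sums_point: "(\<lambda>i. len \<omega> i / \<alpha> ^ Suc (\<omega> i)) sums point \<omega>" for \<omega>
    unfolding point_def by (rule summable_sums[OF summable_summand])
  show ?thesis
  proof
    assume exp: "is_alpha_expansion \<alpha> x d"
    define \<omega> where "\<omega> i = d i - 1" for i
    have "0 < d i" for i
      using exp by (simp add: is_alpha_expansion_def Suc_le_eq)
    then have d: "d = (\<lambda>i. Suc (\<omega> i))"
      by (simp add: \<omega>_def fun_eq_iff)
    then have "x = point \<omega>"
      using exp sums_unique2[OF sums_point[of \<omega>]]
      by (simp add: is_alpha_expansion_def term_eq)
    then show "\<exists>\<omega>. d = (\<lambda>i. Suc (\<omega> i)) \<and> x = point \<omega>"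
      using d by blast
  next
    assume "\<exists>\<omega>. d = (\<lambda>i. Suc (\<omega> i)) \<and> x = point \<omega>"
    then show "is_alpha_expansion \<alpha> x d"
      using sums_point by (auto simp: is_alpha_expansion_def term_eq simp del: sum.atMost_Suc)
  qed
qed

lemma alpha_digits_point: "alpha_digits \<alpha> (point \<omega>) = (\<lambda>i. Suc (\<omega> i))"
  unfolding alpha_digits_def is_alpha_expansion_iff
  by (rule the_equality) (auto dest: injD[OF inj_point])

lemma digit_mean_set_eq: "digit_mean_set \<alpha> \<beta> = point ` {\<omega>. has_digit_mean \<beta> \<omega>}"
proof -
  have "point \<omega> \<in> digit_mean_set \<alpha> \<beta> \<longleftrightarrow> has_digit_mean \<beta> \<omega>" for \<omega>
    by (simp add: digit_mean_set_def alpha_digits_point has_digit_mean_def digit_sum_def point_bounds)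
  moreover have "digit_mean_set \<alpha> \<beta> \<subseteq> range point"
  proof
    fix x assume "x \<in> digit_mean_set \<alpha> \<beta>"
    then have "0 < x" "x \<le> 1" by (auto simp: digit_mean_set_def)
    then obtain \<omega> where "point \<omega> = x" by (rule point_surj)
    then show "x \<in> range point" by blast
  qed
  ultimately show ?thesis by auto
qed

end

section \<open>Independent geometric digits\<close>

locale geometric_digits =
  fixes \<beta> :: real
  assumes beta_gt_1: "1 < \<beta>"
begin

definition digit_pmf :: "nat pmf" where
  "digit_pmf = geometric_pmf (1 / \<beta>)"

definition P :: "(nat \<Rightarrow> nat) measure" where
  "P = (\<Pi>\<^sub>M i\<in>UNIV. measure_pmf digit_pmf)"

definition mass :: "(nat \<Rightarrow> nat) \<Rightarrow> nat \<Rightarrow> real" where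
  "mass \<omega> k = (\<Prod>i<k. pmf digit_pmf (\<omega> i))"

definition cylinder :: "(nat \<Rightarrow> nat) \<Rightarrow> nat \<Rightarrow> (nat \<Rightarrow> nat) set" where
  "cylinder \<omega> k = {\<omega>'. \<forall>i<k. \<omega>' i = \<omega> i}"

sublocale product_prob_space "\<lambda>_. measure_pmf digit_pmf" "UNIV :: nat set"
  by unfold_locales

lemma prob_space_P: "prob_space P"
  unfolding P_def by unfold_locales

lemma space_P [simp]: "space P = UNIV"
  by (simp add: P_def space_PiM)

lemma UNIV_sets_P [simp]: "UNIV \<in> sets P"
  using sets.top[of P] by (simp only: space_P)

lemma measurable_digit [measurable]: "(\<lambda>\<omega>. \<omega> i) \<in> P \<rightarrow>\<^sub>M count_space UNIV"
proof -
  have "(\<lambda>\<omega>. \<omega> i) \<in> P \<rightarrow>\<^sub>M measure_pmf digit_pmf"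
    unfolding P_def by (rule measurable_component_singleton) simp
  then show ?thesis by simp
qed

lemma pmf_digit_pmf: "pmf digit_pmf n = (1 - 1 / \<beta>) ^ n / \<beta>"
  using beta_gt_1 by (simp add: digit_pmf_def pmf_geometric)

lemma pmf_digit_pmf_pos: "0 < pmf digit_pmf n"
  using beta_gt_1 by (simp add: pmf_digit_pmf)

lemma pmf_digit_pmf_le: "pmf digit_pmf n \<le> 1 / \<beta>"
  unfolding pmf_digit_pmf using beta_gt_1 by (intro divide_right_mono power_le_one) auto

lemma mass_pos: "0 < mass \<omega> k"
  by (simp add: mass_def prod_pos pmf_digit_pmf_pos)

lemma mass_le: "mass \<omega> k \<le> (1 / \<beta>) ^ k"
proof -
  have "mass \<omega> k \<le> (\<Prod>i<k. 1 / \<beta>)"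
    unfolding mass_def by (intro prod_mono conjI pmf_digit_pmf_le less_imp_le[OF pmf_digit_pmf_pos])
  then show ?thesis by simp
qed

lemma cylinder_sets [measurable]: "cylinder \<omega> k \<in> sets P"
proof -
  have "{\<omega>' \<in> space P. \<forall>i<k. \<omega>' i = \<omega> i} \<in> sets P"
    by measurable
  then show ?thesis by (simp add: cylinder_def)
qed

lemma emeasure_cylinder: "emeasure P (cylinder \<omega> k) = ennreal (mass \<omega> k)"
proof -
  have "cylinder \<omega> k = {\<omega>' \<in> space P. \<forall>i\<in>{..<k}. \<omega>' i \<in> {\<omega> i}}"
    by (auto simp: cylinder_def)
  then have "emeasure P (cylinder \<omega> k) = (\<Prod>i<k. emeasure (measure_pmf digit_pmf) {\<omega> i})"
    unfolding P_def by (simp only:) (rule emeasure_PiM_Collect; simp)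
  also have "\<dots> = ennreal (mass \<omega> k)"
    by (simp add: emeasure_pmf_single mass_def prod_ennreal)
  finally show ?thesis .
qed

lemma emeasure_singleton: "emeasure P {\<omega>} = 0" "{\<omega>} \<in> sets P"
proof -
  have eq: "{\<omega>} = (\<Inter>k. cylinder \<omega> k)"
    unfolding cylinder_def by (auto intro!: ext)
  show "{\<omega>} \<in> sets P"
    unfolding eq by (intro sets.countable_INT) (auto intro: cylinder_sets)
  have "emeasure P {\<omega>} \<le> 0"
  proof (rule LIMSEQ_le_const)
    have "(\<lambda>k. (1 / \<beta>) ^ k) \<longlonglongrightarrow> 0"
      using beta_gt_1 by (intro LIMSEQ_realpow_zero) auto
    then show "(\<lambda>k. ennreal ((1 / \<beta>) ^ k)) \<longlonglongrightarrow> 0"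
      using tendsto_ennrealI by fastforce
    have "emeasure P {\<omega>} \<le> ennreal ((1 / \<beta>) ^ k)" for k
    proof -
      have "emeasure P {\<omega>} \<le> emeasure P (cylinder \<omega> k)"
        by (rule emeasure_mono[OF _ cylinder_sets]) (simp add: cylinder_def)
      also have "\<dots> \<le> ennreal ((1 / \<beta>) ^ k)"
        by (simp only: emeasure_cylinder ennreal_leI mass_le)
      finally show ?thesis .
    qed
    then show "\<exists>N. \<forall>k\<ge>N. emeasure P {\<omega>} \<le> ennreal ((1 / \<beta>) ^ k)" by blast
  qed
  then show "emeasure P {\<omega>} = 0" by simp
qed

definition seq_of_word :: "nat list \<Rightarrow> nat \<Rightarrow> nat" where
  "seq_of_word w i = (if i < length w then w ! i else 0)"

text \<open>
  Words of equal length index disjoint cylinders, so their probabilities add up to at most one.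
\<close>

lemma suminf_disjoint_cylinders_le:
  fixes w :: "nat \<Rightarrow> nat list"
  assumes "inj w"
  shows "(\<Sum>n. if length (w n) = k then ennreal (mass (seq_of_word (w n)) k) else 0) \<le> 1"
proof -
  interpret prob_space P by (rule prob_space_P)
  define B where "B n = (if length (w n) = k then cylinder (seq_of_word (w n)) k else {})" for n
  have "disjoint_family B"
    unfolding disjoint_family_on_def
  proof (intro ballI impI)
    fix m n :: nat assume "m \<noteq> n"
    then have neq: "w m \<noteq> w n" using \<open>inj w\<close> by (auto dest: injD)
    show "B m \<inter> B n = {}"
    proof (rule ccontr)
      assume "B m \<inter> B n \<noteq> {}"
      then obtain \<omega> where "\<omega> \<in> B m" "\<omega> \<in> B n" by blast
      then have "length (w m) = k" "length (w n) = k"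
          "\<forall>i<k. \<omega> i = w m ! i" "\<forall>i<k. \<omega> i = w n ! i"
        by (auto simp: B_def cylinder_def seq_of_word_def split: if_splits)
      then have "w m = w n" by (intro nth_equalityI) auto
      with neq show False by simp
    qed
  qed
  moreover have "range B \<subseteq> sets P"
    by (auto simp: B_def)
  ultimately have "(\<Sum>n. emeasure P (B n)) = emeasure P (\<Union>n. B n)"
    by (intro suminf_emeasure)
  also have "\<dots> \<le> 1" by (rule emeasure_le_1)
  also have "(\<lambda>n. emeasure P (B n)) = (\<lambda>n. if length (w n) = k then ennreal (mass (seq_of_word (w n)) k) else 0)"
    by (auto simp: B_def emeasure_cylinder)
  finally show ?thesis .
qed

text \<open>
  Independence, in the only form that the exponential moments of digit sums require.
\<close>

lemma nn_integral_prod_digits: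
  "(\<integral>\<^sup>+\<omega>. (\<Prod>i<k. f (\<omega> i)) \<partial>P) = (\<integral>\<^sup>+n. f n \<partial>measure_pmf digit_pmf) ^ k"
proof -
  have "(\<integral>\<^sup>+n. f n \<partial>measure_pmf digit_pmf) ^ k
      = (\<integral>\<^sup>+x. (\<Prod>i<k. f (x i)) \<partial>(\<Pi>\<^sub>M i\<in>{..<k}. measure_pmf digit_pmf))"
    by (subst product_nn_integral_prod) auto
  also have "\<dots> = (\<integral>\<^sup>+x. (\<Prod>i<k. f (x i)) \<partial>distr P (\<Pi>\<^sub>M i\<in>{..<k}. measure_pmf digit_pmf) (\<lambda>x. restrict x {..<k}))"
    unfolding P_def by (subst distr_PiM_restrict_finite) auto
  also have "\<dots> = (\<integral>\<^sup>+\<omega>. (\<Prod>i<k. f (restrict \<omega> {..<k} i)) \<partial>P)"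
    unfolding P_def by (rule nn_integral_distr) (auto intro!: measurable_restrict_subset borel_measurable_prod_ennreal measurable_compose[OF measurable_component_singleton])
  also have "\<dots> = (\<integral>\<^sup>+\<omega>. (\<Prod>i<k. f (\<omega> i)) \<partial>P)"
    by simp
  finally show ?thesis by simp
qed

text \<open>
  The expectation of \<open>z powr (d - b)\<close> for a single digit \<open>d\<close>, see \<open>nn_integral_powr_digit\<close>.
\<close>

definition chernoff_base :: "real \<Rightarrow> real \<Rightarrow> real" where
  "chernoff_base b z = z powr (1 - b) / (\<beta> - (\<beta> - 1) * z)"

lemma nn_integral_powr_digit:
  assumes "0 < z" "(\<beta> - 1) * z < \<beta>"
  shows "(\<integral>\<^sup>+n. ennreal (z powr (real (Suc n) - b)) \<partial>measure_pmf digit_pmf) = ennreal (chernoff_base b z)"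
proof -
  have term_eq: "pmf digit_pmf n * z powr (real (Suc n) - b) = z powr (1 - b) / \<beta> * ((1 - 1 / \<beta>) * z) ^ n" for n
  proof -
    have "z powr (real (Suc n) - b) = z powr (1 - b) * z ^ n"
      using \<open>0 < z\<close> by (simp flip: powr_realpow powr_add add: algebra_simps)
    then show ?thesis by (simp add: pmf_digit_pmf power_mult_distrib)
  qed
  have "norm ((1 - 1 / \<beta>) * z) < 1"
    using assms beta_gt_1 by (simp add: field_simps)
  then have "(\<lambda>n. z powr (1 - b) / \<beta> * ((1 - 1 / \<beta>) * z) ^ n)
      sums (z powr (1 - b) / \<beta> * (1 / (1 - (1 - 1 / \<beta>) * z)))"
    by (intro sums_mult geometric_sums)
  also have "z powr (1 - b) / \<beta> * (1 / (1 - (1 - 1 / \<beta>) * z)) = chernoff_base b z"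
    using beta_gt_1 assms(2) by (simp add: chernoff_base_def field_simps)
  finally have sums: "(\<lambda>n. pmf digit_pmf n * z powr (real (Suc n) - b)) sums chernoff_base b z"
    by (simp only: term_eq)
  have "(\<integral>\<^sup>+n. ennreal (z powr (real (Suc n) - b)) \<partial>measure_pmf digit_pmf)
      = (\<Sum>n. ennreal (pmf digit_pmf n * z powr (real (Suc n) - b)))"
    by (simp add: nn_integral_measure_pmf nn_integral_count_space_nat ennreal_mult)
  also have "\<dots> = ennreal (chernoff_base b z)"
    by (rule suminf_ennreal_eq[OF _ sums]) simp
  finally show ?thesis .
qed

text \<open>
  Markov's inequality for \<open>z powr (S - k * b)\<close>, whose expectation factorizes over the digits. A base
  \<open>z\<close> above one bounds the upper tail of the digit sum \<open>S\<close>, a base below one the lower tail.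
\<close>

lemma chernoff_bound:
  assumes "0 < z" "(\<beta> - 1) * z < \<beta>"
  shows "measure P {\<omega>. 1 \<le> z powr (digit_sum \<omega> k - real k * b)} \<le> chernoff_base b z ^ k"
proof -
  interpret prob_space P by (rule prob_space_P)
  have prod_eq: "(\<Prod>i<k. ennreal (z powr (real (Suc (\<omega> i)) - b))) = ennreal (z powr (digit_sum \<omega> k - real k * b))" for \<omega>
  proof -
    have "(\<Prod>i<k. z powr (real (Suc (\<omega> i)) - b)) = z powr (\<Sum>i<k. real (Suc (\<omega> i)) - b)"
      using \<open>0 < z\<close> by (subst powr_sum) auto
    then show ?thesis
      by (simp add: prod_ennreal digit_sum_def sum_subtractf)
  qed
  have [measurable]: "(\<lambda>\<omega>. digit_sum \<omega> k) \<in> borel_measurable P"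
    unfolding digit_sum_def by measurable
  have one_le_iff: "1 \<le> ennreal x \<longleftrightarrow> 1 \<le> x" for x
    using ennreal_le_iff2[of 1 x] by auto
  have "emeasure P {\<omega>. 1 \<le> z powr (digit_sum \<omega> k - real k * b)}
      = emeasure P ({\<omega>\<in>space P. 1 \<le> 1 * ennreal (z powr (digit_sum \<omega> k - real k * b))})"
    by (simp add: one_le_iff)
  also have "\<dots> \<le> 1 * (\<integral>\<^sup>+\<omega>. ennreal (z powr (digit_sum \<omega> k - real k * b)) * indicator (space P) \<omega> \<partial>P)"
    by (rule nn_integral_Markov_inequality) auto
  also have "\<dots> = (\<integral>\<^sup>+\<omega>. (\<Prod>i<k. ennreal (z powr (real (Suc (\<omega> i)) - b))) \<partial>P)"
    unfolding prod_eq by simp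
  also have "\<dots> = ennreal (chernoff_base b z) ^ k"
    using nn_integral_prod_digits[where f = "\<lambda>n. ennreal (z powr (real (Suc n) - b))" and k = k]
    by (simp only: nn_integral_powr_digit[OF assms])
  finally show ?thesis
    using assms by (simp add: emeasure_eq_measure ennreal_power chernoff_base_def)
qed

lemma AE_eventually_powr_lt_1:
  assumes "0 < z" "(\<beta> - 1) * z < \<beta>" "chernoff_base b z < 1"
  shows "AE \<omega> in P. \<forall>\<^sub>F k in sequentially. z powr (digit_sum \<omega> k - real k * b) < 1"
proof -
  interpret prob_space P by (rule prob_space_P)
  define A where "A k = {\<omega>. 1 \<le> z powr (digit_sum \<omega> k - real k * b)}" for k
  have [measurable]: "(\<lambda>\<omega>. digit_sum \<omega> k) \<in> borel_measurable P" for k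
    unfolding digit_sum_def by measurable
  have "{\<omega> \<in> space P. 1 \<le> z powr (digit_sum \<omega> k - real k * b)} \<in> sets P" for k
    by measurable
  then have "AE \<omega> in P. \<forall>\<^sub>F k in sequentially. \<omega> \<in> space P - A k"
  proof (intro borel_cantelli_AE1)
    have "0 \<le> chernoff_base b z"
      using assms by (simp add: chernoff_base_def)
    then have "summable (\<lambda>k. chernoff_base b z ^ k)"
      using assms(3) by (intro summable_geometric) simp
    then show "summable (\<lambda>k. measure P (A k))"
      by (rule summable_comparison_test') (use chernoff_bound[OF assms(1,2)] in \<open>simp add: A_def\<close>)
  qed (auto simp: A_def emeasure_eq_measure)
  then show ?thesis
    by (simp add: A_def not_le)
qed

text \<open>
  The function equals one at \<open>z = 1\<close> and its slope there is the mean digit minus \<open>b\<close>. Hence it drops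
  below one on one side of \<open>1\<close>: on the right if \<open>b > \<beta>\<close>, on the left if \<open>b < \<beta>\<close>.
\<close>

lemma DERIV_chernoff_base: "(chernoff_base b has_real_derivative (\<beta> - b)) (at 1)"
  unfolding chernoff_base_def[abs_def]
  by (auto intro!: derivative_eq_intros simp: algebra_simps)

lemma chernoff_base_1: "chernoff_base b 1 = 1"
  by (simp add: chernoff_base_def)

lemma AE_digit_sum_upper:
  assumes "\<beta> < b"
  shows "AE \<omega> in P. \<forall>\<^sub>F k in sequentially. digit_sum \<omega> k < real k * b"
proof -
  obtain d where d: "0 < d" "\<And>h. 0 < h \<Longrightarrow> h < d \<Longrightarrow> chernoff_base b (1 + h) < 1"
    using DERIV_neg_dec_right[OF DERIV_chernoff_base] assms by (auto simp: chernoff_base_1)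
  \<comment> \<open>The second bound keeps \<open>1 + h\<close> inside the domain where the geometric moment is finite.\<close>
  define h where "h = min (d / 2) (1 / (2 * (\<beta> - 1)))"
  have h: "0 < h" "h < d"
    using d(1) beta_gt_1 by (auto simp: h_def)
  have "h * (\<beta> - 1) \<le> 1 / (2 * (\<beta> - 1)) * (\<beta> - 1)"
    unfolding h_def using beta_gt_1 by (intro mult_right_mono) auto
  also have "\<dots> = 1 / 2"
    using beta_gt_1 by simp
  finally have "(\<beta> - 1) * (1 + h) < \<beta>"
    using beta_gt_1 by (simp add: algebra_simps)
  then have "AE \<omega> in P. \<forall>\<^sub>F k in sequentially. (1 + h) powr (digit_sum \<omega> k - real k * b) < 1"
    using h d(2)[of h] by (intro AE_eventually_powr_lt_1) auto
  then show ?thesis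
  proof eventually_elim
    case (elim \<omega>)
    then show ?case
    proof eventually_elim
      case (elim k)
      show ?case
      proof (rule ccontr)
        assume "\<not> ?case"
        then have "1 \<le> (1 + h) powr (digit_sum \<omega> k - real k * b)"
          using h by (intro ge_one_powr_ge_zero) auto
        with elim show False by simp
      qed
    qed
  qed
qed

lemma AE_digit_sum_lower:
  assumes "b < \<beta>"
  shows "AE \<omega> in P. \<forall>\<^sub>F k in sequentially. real k * b < digit_sum \<omega> k"
proof -
  obtain d where d: "0 < d" "\<And>h. 0 < h \<Longrightarrow> h < d \<Longrightarrow> chernoff_base b (1 - h) < 1"
    using DERIV_pos_inc_left[OF DERIV_chernoff_base] assms by (auto simp: chernoff_base_1)
  define h where "h = min (d / 2) (1 / 2)"
  have h: "0 < h" "h < d" "h < 1"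
    using d(1) by (auto simp: h_def)
  have "(\<beta> - 1) * (1 - h) \<le> (\<beta> - 1) * 1"
    using h beta_gt_1 by (intro mult_left_mono) auto
  then have "(\<beta> - 1) * (1 - h) < \<beta>" by simp
  then have "AE \<omega> in P. \<forall>\<^sub>F k in sequentially. (1 - h) powr (digit_sum \<omega> k - real k * b) < 1"
    using h d(2)[of h] by (intro AE_eventually_powr_lt_1) auto
  then show ?thesis
  proof eventually_elim
    case (elim \<omega>)
    then show ?case
    proof eventually_elim
      case (elim k)
      show ?case
      proof (rule ccontr)
        assume "\<not> ?case"
        then have "(1 - h) powr 0 \<le> (1 - h) powr (digit_sum \<omega> k - real k * b)"
          using h by (intro powr_mono') auto
        with elim h show False by simp
      qed
    qed
  qed
qed

text \<open>
  The strong law of large numbers for the digits: the Chernoff bounds are summable in \<open>k\<close>, so the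
  Borel--Cantelli lemma excludes deviations of each size \<open>1 / Suc m\<close>.
\<close>

lemma AE_digit_mean: "AE \<omega> in P. has_digit_mean \<beta> \<omega>"
proof -
  have "AE \<omega> in P. \<forall>m. (\<forall>\<^sub>F k in sequentially. digit_sum \<omega> k < real k * (\<beta> + 1 / Suc m))
      \<and> (\<forall>\<^sub>F k in sequentially. real k * (\<beta> - 1 / Suc m) < digit_sum \<omega> k)"
    unfolding AE_all_countable
    by (intro allI AE_conjI AE_digit_sum_upper AE_digit_sum_lower) auto
  then show ?thesis
  proof eventually_elim
    case (elim \<omega>)
    show ?case
      unfolding has_digit_mean_def
    proof (rule tendstoI)
      fix e :: real assume "0 < e"
      then obtain m where m: "1 / Suc m < e"
        using nat_approx_posE by blast
      have "\<forall>\<^sub>F k in sequentially. digit_sum \<omega> k < real k * (\<beta> + 1 / Suc m)"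
           "\<forall>\<^sub>F k in sequentially. real k * (\<beta> - 1 / Suc m) < digit_sum \<omega> k"
        using elim by auto
      then show "\<forall>\<^sub>F k in sequentially. dist (digit_sum \<omega> k / real k) \<beta> < e"
        using eventually_gt_at_top[of 0]
      proof eventually_elim
        case (elim k)
        then have "digit_sum \<omega> k / real k < \<beta> + 1 / Suc m" "\<beta> - 1 / Suc m < digit_sum \<omega> k / real k"
          by (simp_all add: pos_divide_less_eq pos_less_divide_eq mult.commute)
        then show ?case using m by (simp add: dist_real_def abs_less_iff)
      qed
    qed
  qed
qed

section \<open>Decay rates of mass and length\<close>

text \<open>
  The Shannon entropy of the geometric distribution with mean \<open>\<beta>\<close>.
\<close>

definition digit_entropy :: real where
  "digit_entropy = (1 - \<beta>) * ln (\<beta> - 1) + \<beta> * ln \<beta>"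

lemma digit_entropy_pos: "0 < digit_entropy"
proof -
  have "0 < ln \<beta> + (\<beta> - 1) * (ln \<beta> - ln (\<beta> - 1))"
    using beta_gt_1 by (intro add_pos_pos mult_pos_pos) auto
  then show ?thesis by (simp add: digit_entropy_def algebra_simps)
qed

lemma ln_mass: "ln (mass \<omega> k) = (digit_sum \<omega> k - real k) * ln (\<beta> - 1) - digit_sum \<omega> k * ln \<beta>"
proof -
  have "pmf digit_pmf n = (\<beta> - 1) ^ n / \<beta> ^ Suc n" for n
    using beta_gt_1 by (simp add: pmf_digit_pmf diff_divide_eq_iff power_divide)
  then have "ln (pmf digit_pmf n) = real n * ln (\<beta> - 1) - real (Suc n) * ln \<beta>" for n
    using beta_gt_1 by (simp add: ln_div ln_realpow del: power_Suc of_nat_Suc)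
  then have "ln (mass \<omega> k) = (\<Sum>i<k. (real (Suc (\<omega> i)) - 1) * ln (\<beta> - 1) - real (Suc (\<omega> i)) * ln \<beta>)"
    unfolding mass_def using pmf_digit_pmf_pos by (subst ln_prod) (auto simp: less_le)
  also have "\<dots> = (digit_sum \<omega> k - real k) * ln (\<beta> - 1) - digit_sum \<omega> k * ln \<beta>"
    by (simp add: digit_sum_def sum_subtractf sum.distrib flip: sum_distrib_right)
  finally show ?thesis .
qed

lemma ln_mass_rate:
  assumes "has_digit_mean \<beta> \<omega>"
  shows "(\<lambda>k. ln (mass \<omega> k) / real k) \<longlonglongrightarrow> - digit_entropy"
proof -
  have "(\<lambda>k. (digit_sum \<omega> k / real k - 1) * ln (\<beta> - 1) - digit_sum \<omega> k / real k * ln \<beta>)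
      \<longlonglongrightarrow> (\<beta> - 1) * ln (\<beta> - 1) - \<beta> * ln \<beta>"
    using assms unfolding has_digit_mean_def by (intro tendsto_intros)
  also have "(\<beta> - 1) * ln (\<beta> - 1) - \<beta> * ln \<beta> = - digit_entropy"
    by (simp add: digit_entropy_def algebra_simps)
  finally show ?thesis
  proof (rule Lim_transform_eventually)
    show "\<forall>\<^sub>F k in sequentially. (digit_sum \<omega> k / real k - 1) * ln (\<beta> - 1) - digit_sum \<omega> k / real k * ln \<beta>
        = ln (mass \<omega> k) / real k"
      using eventually_gt_at_top[of 0]
      by eventually_elim (simp add: ln_mass field_simps)
  qed
qed

end

locale alpha_geometric = alpha_coding \<alpha> + geometric_digits \<beta> for \<alpha> \<beta> :: real
begin

text \<open>
  The mean of the negative logarithm of the contraction ratio belonging to a geometric digit.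
\<close>

definition lyapunov :: real where
  "lyapunov = - ln (\<alpha> - 1) + \<beta> * ln \<alpha>"

lemma lyapunov_pos: "0 < lyapunov"
proof -
  have "ln (\<alpha> - 1) < ln \<alpha>" using alpha_gt_1 by simp
  also have "1 * ln \<alpha> \<le> \<beta> * ln \<alpha>"
    using alpha_gt_1 beta_gt_1 by (intro mult_right_mono) auto
  finally show ?thesis by (simp add: lyapunov_def)
qed

lemma ln_len: "ln (len \<omega> k) = real k * ln (\<alpha> - 1) - digit_sum \<omega> k * ln \<alpha>"
  using alpha_gt_1 unfolding len_eq digit_sum_def
  by (simp add: ln_div ln_realpow del: of_nat_sum)

lemma ln_len_rate:
  assumes "has_digit_mean \<beta> \<omega>"
  shows "(\<lambda>k. ln (len \<omega> k) / real k) \<longlonglongrightarrow> - lyapunov"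
proof -
  have "(\<lambda>k. ln (\<alpha> - 1) - digit_sum \<omega> k / real k * ln \<alpha>) \<longlonglongrightarrow> ln (\<alpha> - 1) - \<beta> * ln \<alpha>"
    using assms unfolding has_digit_mean_def by (intro tendsto_intros)
  also have "ln (\<alpha> - 1) - \<beta> * ln \<alpha> = - lyapunov"
    by (simp add: lyapunov_def)
  finally show ?thesis
  proof (rule Lim_transform_eventually)
    show "\<forall>\<^sub>F k in sequentially. ln (\<alpha> - 1) - digit_sum \<omega> k / real k * ln \<alpha> = ln (len \<omega> k) / real k"
      using eventually_gt_at_top[of 0]
      by eventually_elim (simp add: ln_len field_simps)
  qed
qed

section \<open>Upper bound by covers with basic intervals\<close>

lemma eventually_len_powr_le:
  assumes mean: "has_digit_mean \<beta> \<omega>" and \<epsilon>: "\<epsilon> < t * lyapunov - digit_entropy"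
  shows "\<forall>\<^sub>F k in sequentially. len \<omega> k powr t \<le> exp (- \<epsilon>) ^ k * mass \<omega> k"
proof -
  have "(\<lambda>k. t * (ln (len \<omega> k) / real k) - ln (mass \<omega> k) / real k) \<longlonglongrightarrow> t * - lyapunov - - digit_entropy"
    by (intro tendsto_intros ln_len_rate ln_mass_rate mean)
  then have "\<forall>\<^sub>F k in sequentially. t * (ln (len \<omega> k) / real k) - ln (mass \<omega> k) / real k < - \<epsilon>"
    by (rule order_tendstoD(2)) (use \<epsilon> in simp)
  then show ?thesis
    using eventually_gt_at_top[of 0]
  proof eventually_elim
    case (elim k)
    then have "t * ln (len \<omega> k) \<le> real k * (- \<epsilon>) + ln (mass \<omega> k)"
      by (simp add: field_simps)
    then have "exp (t * ln (len \<omega> k)) \<le> exp (real k * (- \<epsilon>) + ln (mass \<omega> k))"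
      by (simp only: exp_le_cancel_iff)
    also have "\<dots> = exp (- \<epsilon>) ^ k * mass \<omega> k"
      using mass_pos[of \<omega> k] by (simp only: exp_add exp_of_nat_mult exp_ln)
    finally show ?case
      using len_pos[of \<omega> k] by (simp add: powr_def)
  qed
qed

text \<open>
  The gap between \<open>t * lyapunov\<close> and the entropy leaves a factor \<open>\<rho>^k\<close> at level \<open>k\<close>, so all levels
  together can be used in one cover: their contributions form the tail of a geometric series.
\<close>

lemma hausdorff_measure_eq_0:
  assumes t: "digit_entropy / lyapunov < t"
  shows "hausdorff_measure t (digit_mean_set \<alpha> \<beta>) = 0"
proof -
  have "0 < digit_entropy / lyapunov"
    using digit_entropy_pos lyapunov_pos by simp
  then have "0 < t" using t by simp
  have "0 < t * lyapunov - digit_entropy"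
    using t lyapunov_pos by (simp add: pos_divide_less_eq)
  then obtain \<epsilon> where \<epsilon>: "0 < \<epsilon>" "\<epsilon> < t * lyapunov - digit_entropy"
    using dense by blast
  define \<rho> where "\<rho> = exp (- \<epsilon>)"
  have \<rho>: "0 < \<rho>" "\<rho> < 1" using \<epsilon> by (auto simp: \<rho>_def)
  define w :: "nat \<Rightarrow> nat list" where "w = from_nat_into UNIV"
  have "bij_betw w UNIV UNIV"
    unfolding w_def by (intro bij_betw_from_nat_into countableI_type infinite_UNIV_listI)
  then have "inj w" "surj w" by (auto simp: bij_betw_def)
  define good where "good u \<longleftrightarrow> len (seq_of_word u) (length u) powr t
      \<le> \<rho> ^ length u * mass (seq_of_word u) (length u)" for u
  \<comment> \<open>The cover consists of the good intervals of all levels from \<open>K\<close> on; \<open>m\<close> counts the level and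
      \<open>n\<close> runs through all words, those of a wrong length contributing the empty set.\<close>
  define U where "U K = (\<lambda>(m, n). if length (w n) = m + K \<and> good (w n)
      then cyl_interval (seq_of_word (w n)) (m + K) else {})" for K :: nat
  have total: "(\<Sum>i. diam_power t (U K (prod_decode i))) \<le> ennreal (\<rho> ^ K * (1 / (1 - \<rho>)))" for K
  proof -
    have level: "(\<Sum>n. diam_power t (U K (m, n))) \<le> ennreal (\<rho> ^ (m + K))" for m
    proof -
      have "diam_power t (U K (m, n)) \<le> ennreal (\<rho> ^ (m + K)) *
          (if length (w n) = m + K then ennreal (mass (seq_of_word (w n)) (m + K)) else 0)" for n
      proof (cases "length (w n) = m + K \<and> good (w n)")
        case True
        let ?u = "seq_of_word (w n)"
        have "diam_power t (U K (m, n)) = ennreal (len ?u (m + K) powr t)"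
          using True \<open>0 < t\<close> by (simp add: U_def diam_power_cyl_interval)
        also have "\<dots> \<le> ennreal (\<rho> ^ (m + K) * mass ?u (m + K))"
          using True unfolding good_def by (intro ennreal_leI) metis
        also have "\<dots> = ennreal (\<rho> ^ (m + K)) * ennreal (mass ?u (m + K))"
          using \<rho> by (intro ennreal_mult less_imp_le[OF mass_pos]) simp
        finally show ?thesis using True by simp
      next
        case False
        then have "U K (m, n) = {}"
          unfolding U_def by (simp only: prod.case if_False)
        then show ?thesis by (simp add: diam_power_def)
      qed
      then have "(\<Sum>n. diam_power t (U K (m, n))) \<le> (\<Sum>n. ennreal (\<rho> ^ (m + K)) *
          (if length (w n) = m + K then ennreal (mass (seq_of_word (w n)) (m + K)) else 0))"
        by (intro suminf_le) auto
      also have "\<dots> = ennreal (\<rho> ^ (m + K)) *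
          (\<Sum>n. if length (w n) = m + K then ennreal (mass (seq_of_word (w n)) (m + K)) else 0)"
        by simp
      also have "\<dots> \<le> ennreal (\<rho> ^ (m + K)) * 1"
        by (intro mult_left_mono suminf_disjoint_cylinders_le \<open>inj w\<close>) auto
      finally show ?thesis by simp
    qed
    have "(\<Sum>i. diam_power t (U K (prod_decode i))) = (\<Sum>m. \<Sum>n. diam_power t (U K (m, n)))"
      by (rule suminf_ennreal_2dimen) simp
    also have "\<dots> \<le> (\<Sum>m. ennreal (\<rho> ^ (m + K)))"
      by (intro suminf_le level) auto
    also have "\<dots> = ennreal (\<rho> ^ K * (1 / (1 - \<rho>)))"
    proof (rule suminf_ennreal_eq)
      show "(\<lambda>m. \<rho> ^ (m + K)) sums (\<rho> ^ K * (1 / (1 - \<rho>)))"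
        unfolding power_add mult.commute[of _ "\<rho> ^ K"]
        using \<rho> by (intro sums_mult geometric_sums) auto
    qed (use \<rho> in auto)
    finally show ?thesis .
  qed
  have covers: "digit_mean_set \<alpha> \<beta> \<subseteq> (\<Union>i. U K (prod_decode i))" for K
  proof
    fix x assume "x \<in> digit_mean_set \<alpha> \<beta>"
    then obtain \<omega> where \<omega>: "x = point \<omega>" "has_digit_mean \<beta> \<omega>"
      by (auto simp: digit_mean_set_eq)
    obtain N where N: "\<And>k. N \<le> k \<Longrightarrow> len \<omega> k powr t \<le> \<rho> ^ k * mass \<omega> k"
      using eventually_len_powr_le[OF \<omega>(2) \<epsilon>(2)] by (auto simp: eventually_sequentially \<rho>_def)
    define k where "k = N + K"
    obtain n where n: "w n = map \<omega> [0..<k]"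
      using \<open>surj w\<close> by (metis surjD)
    have agree: "seq_of_word (w n) i = \<omega> i" if "i < k" for i
      using that by (simp add: n seq_of_word_def)
    have "len (seq_of_word (w n)) k = len \<omega> k" "mass (seq_of_word (w n)) k = mass \<omega> k"
      by (auto simp: len_def mass_def agree)
    then have "good (w n)"
      using N[of k] by (simp add: good_def n k_def)
    then have "U K (N, n) = cyl_interval \<omega> k"
      using cyl_interval_cong[OF agree] by (simp add: U_def n k_def)
    then have "x \<in> U K (prod_decode (prod_encode (N, n)))"
      using point_in_cyl_interval \<omega>(1) by simp
    then show "x \<in> (\<Union>i. U K (prod_decode i))" by blast
  qed
  have small: "bounded (U K p)" "diameter (U K p) \<le> ((\<alpha> - 1) / \<alpha>) ^ K" for K p
  proof -
    show "bounded (U K p)"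
      by (auto simp: U_def cyl_interval_def split: prod.split)
    have "len \<omega> (m + K) \<le> ((\<alpha> - 1) / \<alpha>) ^ K" for \<omega> m
      using alpha_gt_1 by (intro order_trans[OF len_le] power_decreasing) auto
    then show "diameter (U K p) \<le> ((\<alpha> - 1) / \<alpha>) ^ K"
      using alpha_gt_1 by (auto simp: U_def diameter_cyl_interval split: prod.split)
  qed
  have "hausdorff_premeasure t \<delta> (digit_mean_set \<alpha> \<beta>) \<le> 0" if "0 < \<delta>" for \<delta>
  proof (rule LIMSEQ_le_const)
    have "(\<lambda>K. \<rho> ^ K * (1 / (1 - \<rho>))) \<longlonglongrightarrow> 0 * (1 / (1 - \<rho>))"
      using \<rho> by (intro tendsto_mult tendsto_const LIMSEQ_realpow_zero) auto
    then show "(\<lambda>K. ennreal (\<rho> ^ K * (1 / (1 - \<rho>)))) \<longlonglongrightarrow> 0"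
      using tendsto_ennrealI by fastforce
    have "\<forall>\<^sub>F K in sequentially. ((\<alpha> - 1) / \<alpha>) ^ K < \<delta>"
      using contraction_LIMSEQ \<open>0 < \<delta>\<close> by (rule order_tendstoD)
    then obtain N where N: "\<And>K. N \<le> K \<Longrightarrow> ((\<alpha> - 1) / \<alpha>) ^ K < \<delta>"
      by (auto simp: eventually_sequentially)
    have "hausdorff_premeasure t \<delta> (digit_mean_set \<alpha> \<beta>) \<le> ennreal (\<rho> ^ K * (1 / (1 - \<rho>)))" if "N \<le> K" for K
    proof -
      have "diameter (U K p) \<le> \<delta>" for p
        using small(2)[of K p] N[OF that] by linarith
      then have "(\<lambda>i. U K (prod_decode i)) \<in> delta_covers \<delta> (digit_mean_set \<alpha> \<beta>)"
        using covers small(1) by (simp add: delta_covers_def)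
      then have "hausdorff_premeasure t \<delta> (digit_mean_set \<alpha> \<beta>) \<le> (\<Sum>i. diam_power t (U K (prod_decode i)))"
        unfolding hausdorff_premeasure_def by (rule INF_lower)
      then show ?thesis using total by (rule order_trans)
    qed
    then show "\<exists>N. \<forall>K\<ge>N. hausdorff_premeasure t \<delta> (digit_mean_set \<alpha> \<beta>) \<le> ennreal (\<rho> ^ K * (1 / (1 - \<rho>)))"
      by blast
  qed
  then show ?thesis
    unfolding hausdorff_measure_def by (intro antisym SUP_least) auto
qed

section \<open>Lower bound by mass distribution\<close>

text \<open>
  The sequences with a uniform Frostman-type bound. The mass at level \<open>k\<close> is compared with the length
  at level \<open>Suc k\<close>, since a set whose diameter lies between the two lengths is charged with the whole
  mass of level \<open>k\<close>.
\<close>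

definition frostman :: "real \<Rightarrow> nat \<Rightarrow> (nat \<Rightarrow> nat) set" where
  "frostman t c = {\<omega>. \<forall>k. mass \<omega> k \<le> real (Suc c) * len \<omega> (Suc k) powr t}"

lemma frostman_sets: "frostman t c \<in> sets P"
proof -
  have [measurable]: "(\<lambda>\<omega>. mass \<omega> k) \<in> borel_measurable P" "(\<lambda>\<omega>. len \<omega> k) \<in> borel_measurable P" for k
    unfolding mass_def len_def by measurable
  have "{\<omega> \<in> space P. mass \<omega> k \<le> real (Suc c) * len \<omega> (Suc k) powr t} \<in> sets P" for k
    by (intro borel_measurable_le borel_measurable_times) measurable
  then have "(\<Inter>k. {\<omega> \<in> space P. mass \<omega> k \<le> real (Suc c) * len \<omega> (Suc k) powr t}) \<in> sets P"
    by (intro sets.countable_INT) auto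
  also have "(\<Inter>k. {\<omega> \<in> space P. mass \<omega> k \<le> real (Suc c) * len \<omega> (Suc k) powr t}) = frostman t c"
    by (auto simp: frostman_def)
  finally show ?thesis .
qed

text \<open>
  Along a sequence with digit mean \<open>\<beta>\<close> the shift by one level does not change the exponential decay
  rate of the length, so the quotient of mass and length power is eventually below one. The constant
  takes care of the finitely many initial levels.
\<close>

lemma has_digit_mean_imp_frostman:
  assumes mean: "has_digit_mean \<beta> \<omega>" and t: "t < digit_entropy / lyapunov"
  shows "\<exists>c. \<omega> \<in> frostman t c"
proof -
  define f where "f k = mass \<omega> k / len \<omega> (Suc k) powr t" for k
  have "(\<lambda>k. ln (len \<omega> (Suc k)) / real (Suc k)) \<longlonglongrightarrow> - lyapunov"
    using ln_len_rate[OF mean] by (rule LIMSEQ_Suc)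
  then have "(\<lambda>k. ln (mass \<omega> k) / real k
        - t * (ln (len \<omega> (Suc k)) / real (Suc k) * (real (Suc k) / real k)))
      \<longlonglongrightarrow> - digit_entropy - t * (- lyapunov * 1)"
    by (intro tendsto_intros ln_mass_rate mean LIMSEQ_Suc_n_over_n)
  then have "\<forall>\<^sub>F k in sequentially. ln (mass \<omega> k) / real k
        - t * (ln (len \<omega> (Suc k)) / real (Suc k) * (real (Suc k) / real k)) < 0"
    by (rule order_tendstoD(2)) (use t lyapunov_pos in \<open>simp add: pos_less_divide_eq\<close>)
  then have "\<forall>\<^sub>F k in sequentially. norm (f k) \<le> 1"
    using eventually_gt_at_top[of 0]
  proof eventually_elim
    case (elim k)
    then have "ln (mass \<omega> k) / real k < t * ln (len \<omega> (Suc k)) / real k"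
      by simp
    then have "ln (mass \<omega> k) < t * ln (len \<omega> (Suc k))"
      using elim(2) by (simp add: divide_less_cancel)
    then have "exp (ln (mass \<omega> k)) < exp (t * ln (len \<omega> (Suc k)))"
      by simp
    then have "mass \<omega> k \<le> len \<omega> (Suc k) powr t"
      using mass_pos[of \<omega> k] len_pos[of \<omega> "Suc k"] by (simp add: powr_def)
    then show ?case
      using mass_pos[of \<omega> k] len_pos[of \<omega> "Suc k"] by (simp add: f_def)
  qed
  then have "Bseq f"
    unfolding Bfun_def by (intro exI[of _ 1]) simp
  then obtain c where c: "\<And>k. norm (f k) \<le> real (Suc c)"
    unfolding Bseq_iff by blast
  have "mass \<omega> k \<le> real (Suc c) * len \<omega> (Suc k) powr t" for k
    using c[of k] mass_pos[of \<omega> k] len_pos[of \<omega> "Suc k"] by (simp add: f_def field_simps)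
  then show ?thesis by (auto simp: frostman_def)
qed

text \<open>
  The lengths start at \<open>1\<close> and tend to zero, so they pass every \<open>\<delta> < 1\<close> at some level.
\<close>

lemma stopping_level_exists:
  assumes "\<delta> < 1" "0 < \<delta>"
  shows "\<exists>k. \<delta> < len \<omega> k \<and> len \<omega> (Suc k) \<le> \<delta>"
proof -
  have "\<forall>\<^sub>F k in sequentially. len \<omega> k < \<delta>"
    using len_LIMSEQ \<open>0 < \<delta>\<close> by (rule order_tendstoD)
  then have ex: "\<exists>k. len \<omega> k \<le> \<delta>"
    by (auto simp: eventually_sequentially intro: less_imp_le)
  then obtain n where n: "len \<omega> n \<le> \<delta>" "\<And>m. m < n \<Longrightarrow> \<not> len \<omega> m \<le> \<delta>"
    using exists_least_iff[of "\<lambda>k. len \<omega> k \<le> \<delta>"] by blast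
  then obtain k where "n = Suc k"
    using \<open>\<delta> < 1\<close> by (cases n) auto
  then show ?thesis using n by (auto simp: not_le)
qed

text \<open>
  The basic intervals that contain a given \<open>y\<close> are nested, so the one with the least stopping level
  \<open>\<kappa>\<close> contains the others, and its mass alone bounds the total. The levels \<open>\<kappa> \<omega>\<close> themselves may differ,
  because whether \<open>\<kappa> \<omega> = k\<close> depends on the digit after the first \<open>k\<close>.
\<close>

lemma same_cylinder_cover:
  assumes "0 \<le> t"
    and stop: "\<And>\<omega>. len \<omega> (Suc (\<kappa> \<omega>)) \<le> \<delta>"
  shows "\<exists>E\<in>sets P. (\<forall>\<omega>\<in>frostman t c. y \<in> cyl_interval \<omega> (\<kappa> \<omega>) \<longrightarrow> \<omega> \<in> E)
           \<and> emeasure P E \<le> ennreal (real (Suc c) * \<delta> powr t)"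
proof (cases "\<exists>\<omega>. \<omega> \<in> frostman t c \<and> y \<in> cyl_interval \<omega> (\<kappa> \<omega>)")
  case False
  then show ?thesis by (intro bexI[of _ "{}"]) auto
next
  case True
  then obtain \<xi> where \<xi>: "\<xi> \<in> frostman t c" "y \<in> cyl_interval \<xi> (\<kappa> \<xi>)"
    and least: "\<And>\<omega>. \<omega> \<in> frostman t c \<Longrightarrow> y \<in> cyl_interval \<omega> (\<kappa> \<omega>) \<Longrightarrow> \<kappa> \<xi> \<le> \<kappa> \<omega>"
    using ex_has_least_nat[of "\<lambda>\<omega>. \<omega> \<in> frostman t c \<and> y \<in> cyl_interval \<omega> (\<kappa> \<omega>)" _ \<kappa>] by blast
  obtain \<xi>' where \<xi>': "point \<xi>' = y" "\<And>i. i < \<kappa> \<xi> \<Longrightarrow> \<xi>' i = \<xi> i"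
    using mem_cyl_intervalE[OF \<xi>(2)] by blast
  show ?thesis
  proof (intro bexI[of _ "cylinder \<xi> (\<kappa> \<xi>)"] conjI ballI impI)
    fix \<omega> assume \<omega>: "\<omega> \<in> frostman t c" "y \<in> cyl_interval \<omega> (\<kappa> \<omega>)"
    obtain \<omega>' where \<omega>': "point \<omega>' = y" "\<And>i. i < \<kappa> \<omega> \<Longrightarrow> \<omega>' i = \<omega> i"
      using mem_cyl_intervalE[OF \<omega>(2)] by blast
    have "\<omega>' = \<xi>'"
      using \<xi>'(1) \<omega>'(1) by (auto dest: injD[OF inj_point])
    then have "\<omega> i = \<xi> i" if "i < \<kappa> \<xi>" for i
      using \<xi>'(2)[OF that] \<omega>'(2)[of i] least[OF \<omega>] that by simp
    then show "\<omega> \<in> cylinder \<xi> (\<kappa> \<xi>)"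
      by (simp add: cylinder_def)
  next
    have "mass \<xi> (\<kappa> \<xi>) \<le> real (Suc c) * len \<xi> (Suc (\<kappa> \<xi>)) powr t"
      using \<xi>(1) by (simp add: frostman_def)
    also have "\<dots> \<le> real (Suc c) * \<delta> powr t"
      using \<open>0 \<le> t\<close> stop[of \<xi>] len_pos[of \<xi> "Suc (\<kappa> \<xi>)"]
      by (intro mult_left_mono powr_mono2) auto
    finally show "emeasure P (cylinder \<xi> (\<kappa> \<xi>)) \<le> ennreal (real (Suc c) * \<delta> powr t)"
      by (simp add: emeasure_cylinder ennreal_leI)
  qed simp
qed

text \<open>
  Let \<open>U\<close> have infimum \<open>m\<close> and diameter \<open>\<delta> > 0\<close>. An interval longer than \<open>\<delta>\<close> that meets \<open>U\<close> must contain
  \<open>m\<close> or \<open>m + \<delta>\<close>. So stopping each sequence at an interval longer than \<open>\<delta>\<close> whose successor is not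
  leaves just two families of intervals, each with a common point. If \<open>U\<close> is a singleton, no such
  interval exists, but single sequences have probability zero.
\<close>

lemma frostman_cover:
  assumes "0 \<le> t" "bounded U" "diameter U < 1"
  shows "\<exists>E\<in>sets P. (\<forall>\<omega>\<in>frostman t c. point \<omega> \<in> U \<longrightarrow> \<omega> \<in> E)
           \<and> emeasure P E \<le> ennreal (2 * real (Suc c)) * diam_power t U"
proof (cases "\<exists>\<omega>. point \<omega> \<in> U")
  case False
  then show ?thesis by (intro bexI[of _ "{}"]) auto
next
  case True
  then obtain \<omega>0 where \<omega>0: "point \<omega>0 \<in> U" by blast
  define \<delta> where "\<delta> = diameter U"
  have dist: "\<bar>x - y\<bar> \<le> \<delta>" if "x \<in> U" "y \<in> U" for x y
    using diameter_bounded_bound[OF \<open>bounded U\<close> that] by (simp add: \<delta>_def dist_real_def)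
  have "0 \<le> \<delta>" using dist[OF \<omega>0 \<omega>0] by simp
  show ?thesis
  proof (cases "\<delta> = 0")
    case True
    have "\<omega> = \<omega>0" if "point \<omega> \<in> U" for \<omega>
      using dist[OF that \<omega>0] True by (auto dest: injD[OF inj_point])
    then show ?thesis
      by (intro bexI[of _ "{\<omega>0}"]) (auto simp: emeasure_singleton)
  next
    case False
    then have "0 < \<delta>" "\<delta> < 1" using \<open>0 \<le> \<delta>\<close> assms(3) by (auto simp: \<delta>_def)
    define m where "m = Inf U"
    have below: "bdd_below U"
      using \<open>bounded U\<close> by (rule bounded_imp_bdd_below)
    have U_range: "m \<le> x" "x \<le> m + \<delta>" if "x \<in> U" for x
    proof -
      show "m \<le> x" unfolding m_def using that below by (rule cInf_lower)
      have "x - \<delta> \<le> m"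
        unfolding m_def
      proof (rule cInf_greatest)
        show "x - \<delta> \<le> z" if "z \<in> U" for z
          using dist[OF \<open>x \<in> U\<close> that] by linarith
      qed (use that in blast)
      then show "x \<le> m + \<delta>" by simp
    qed
    obtain \<kappa> where \<kappa>: "\<And>\<omega>. \<delta> < len \<omega> (\<kappa> \<omega>)" "\<And>\<omega>. len \<omega> (Suc (\<kappa> \<omega>)) \<le> \<delta>"
      using stopping_level_exists[OF \<open>\<delta> < 1\<close> \<open>0 < \<delta>\<close>] by metis
    have hits: "m \<in> cyl_interval \<omega> (\<kappa> \<omega>) \<or> m + \<delta> \<in> cyl_interval \<omega> (\<kappa> \<omega>)" if "point \<omega> \<in> U" for \<omega>
      using U_range[OF that] point_in_cyl_interval[of \<omega> "\<kappa> \<omega>"] \<kappa>(1)[of \<omega>]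
      by (auto simp: cyl_interval_def)
    obtain E1 where E1: "E1 \<in> sets P" "\<And>\<omega>. \<omega> \<in> frostman t c \<Longrightarrow> m \<in> cyl_interval \<omega> (\<kappa> \<omega>) \<Longrightarrow> \<omega> \<in> E1"
        "emeasure P E1 \<le> ennreal (real (Suc c) * \<delta> powr t)"
      using same_cylinder_cover[OF \<open>0 \<le> t\<close> \<kappa>(2)] by metis
    obtain E2 where E2: "E2 \<in> sets P" "\<And>\<omega>. \<omega> \<in> frostman t c \<Longrightarrow> m + \<delta> \<in> cyl_interval \<omega> (\<kappa> \<omega>) \<Longrightarrow> \<omega> \<in> E2"
        "emeasure P E2 \<le> ennreal (real (Suc c) * \<delta> powr t)"
      using same_cylinder_cover[OF \<open>0 \<le> t\<close> \<kappa>(2)] by metis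
    have "emeasure P (E1 \<union> E2) \<le> emeasure P E1 + emeasure P E2"
      by (intro emeasure_subadditive E1 E2)
    also have "\<dots> \<le> ennreal (real (Suc c) * \<delta> powr t) + ennreal (real (Suc c) * \<delta> powr t)"
      by (intro add_mono E1 E2)
    also have "\<dots> = ennreal (2 * real (Suc c) * \<delta> powr t)"
      by (simp flip: ennreal_plus)
    also have "\<dots> = ennreal (2 * real (Suc c)) * ennreal (\<delta> powr t)"
      by (rule ennreal_mult) auto
    also have "ennreal (\<delta> powr t) = diam_power t U"
      using \<omega>0 \<open>0 < \<delta>\<close> by (auto simp: diam_power_def \<delta>_def)
    finally show ?thesis
      using E1 E2 hits by (intro bexI[of _ "E1 \<union> E2"]) auto
  qed
qed

text \<open>
  The countably many classes \<open>frostman t c\<close> exhaust almost all sequences, so one of them has positive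
  probability. Every cover of the digit mean set by sets of diameter less than \<open>1\<close> has to pay for it.
\<close>

lemma hausdorff_measure_neq_0:
  assumes "0 \<le> t" "t < digit_entropy / lyapunov"
  shows "hausdorff_measure t (digit_mean_set \<alpha> \<beta>) \<noteq> 0"
proof -
  interpret prob_space P by (rule prob_space_P)
  have "\<exists>c. emeasure P (frostman t c) \<noteq> 0"
  proof (rule ccontr)
    assume "\<not> ?thesis"
    then have "AE \<omega> in P. \<omega> \<notin> frostman t c" for c
      by (intro AE_not_in) (auto simp: null_sets_def frostman_sets)
    then have "AE \<omega> in P. \<forall>c. \<omega> \<notin> frostman t c"
      by (simp add: AE_all_countable)
    then have "AE \<omega> in P. False"
      using AE_digit_mean
      by eventually_elim (use has_digit_mean_imp_frostman assms(2) in blast)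
    then show False by simp
  qed
  then obtain c where c: "emeasure P (frostman t c) \<noteq> 0" by blast
  define C where "C = ennreal (2 * real (Suc c))"
  have C: "0 < C" "C \<noteq> top"
    by (simp_all only: C_def ennreal_less_zero_iff ennreal_neq_top not_False_eq_True) simp
  have "emeasure P (frostman t c) \<le> C * (\<Sum>i. diam_power t (U i))"
    if U: "U \<in> delta_covers (1 / 2) (digit_mean_set \<alpha> \<beta>)" for U
  proof -
    have "bounded (U i)" "diameter (U i) < 1" for i
      using U by (auto simp: delta_covers_def intro: le_less_trans[of _ "1 / 2"])
    then have "\<exists>E. E \<in> sets P \<and> (\<forall>\<omega>\<in>frostman t c. point \<omega> \<in> U i \<longrightarrow> \<omega> \<in> E)
        \<and> emeasure P E \<le> C * diam_power t (U i)" for i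
      using frostman_cover[OF \<open>0 \<le> t\<close>, of "U i" c] by (auto simp: C_def)
    then obtain E where E: "\<And>i. E i \<in> sets P"
        "\<And>i \<omega>. \<omega> \<in> frostman t c \<Longrightarrow> point \<omega> \<in> U i \<Longrightarrow> \<omega> \<in> E i"
        "\<And>i. emeasure P (E i) \<le> C * diam_power t (U i)"
      by metis
    have "AE \<omega> in P. \<omega> \<in> frostman t c \<longrightarrow> \<omega> \<in> (\<Union>i. E i)"
      using AE_digit_mean
    proof eventually_elim
      case (elim \<omega>)
      then have "point \<omega> \<in> digit_mean_set \<alpha> \<beta>"
        by (auto simp: digit_mean_set_eq)
      then obtain i where "point \<omega> \<in> U i"
        using U by (auto simp: delta_covers_def)
      then show ?case using E(2) by blast
    qed
    then have "emeasure P (frostman t c) \<le> emeasure P (\<Union>i. E i)"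
      using E(1) by (intro emeasure_mono_AE) auto
    also have "\<dots> \<le> (\<Sum>i. emeasure P (E i))"
      using E(1) by (intro emeasure_subadditive_countably) auto
    also have "\<dots> \<le> (\<Sum>i. C * diam_power t (U i))"
      by (intro suminf_le E(3)) auto
    finally show ?thesis by simp
  qed
  then have "emeasure P (frostman t c) / C \<le> hausdorff_premeasure t (1 / 2) (digit_mean_set \<alpha> \<beta>)"
    unfolding hausdorff_premeasure_def
    by (intro INF_greatest divide_le_posI_ennreal C)
  also have "\<dots> \<le> hausdorff_measure t (digit_mean_set \<alpha> \<beta>)"
    unfolding hausdorff_measure_def by (rule SUP_upper) simp
  finally show ?thesis
    using c C by auto
qed

section \<open>The dimension formula\<close>

lemma hausdorff_dim_digit_mean_set:
  "hausdorff_dim (digit_mean_set \<alpha> \<beta>) = ereal (digit_entropy / lyapunov)"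
  unfolding hausdorff_dim_def
proof (rule antisym)
  let ?S = "{ereal s |s. 0 \<le> s \<and> hausdorff_measure s (digit_mean_set \<alpha> \<beta>) = 0}"
  show "ereal (digit_entropy / lyapunov) \<le> Inf ?S"
    using hausdorff_measure_neq_0 by (intro Inf_greatest) (force simp: not_less)
  have "0 < digit_entropy / lyapunov"
    using digit_entropy_pos lyapunov_pos by simp
  show "Inf ?S \<le> ereal (digit_entropy / lyapunov)"
  proof (rule ereal_le_epsilon2)
    fix e :: real assume "0 < e"
    then have "0 \<le> digit_entropy / lyapunov + e"
        "hausdorff_measure (digit_entropy / lyapunov + e) (digit_mean_set \<alpha> \<beta>) = 0"
      using \<open>0 < digit_entropy / lyapunov\<close> by (simp_all add: hausdorff_measure_eq_0)
    then have "Inf ?S \<le> ereal (digit_entropy / lyapunov + e)"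
      by (intro Inf_lower) blast
    then show "Inf ?S \<le> ereal (digit_entropy / lyapunov) + ereal e"
      by simp
  qed
qed

end

theorem theorem2p2:
  fixes \<alpha> :: real
  assumes "\<alpha> > 1"
  shows "\<forall>\<beta>>1. hausdorff_dim (digit_mean_set \<alpha> \<beta>) =
    ereal (((1 - \<beta>) * ln (\<beta> - 1) + \<beta> * ln \<beta>) / (- ln (\<alpha> - 1) + \<beta> * ln \<alpha>))"
proof (intro allI impI)
  fix \<beta> :: real assume "1 < \<beta>"
  then interpret alpha_geometric \<alpha> \<beta>
    using assms by unfold_locales
  show "hausdorff_dim (digit_mean_set \<alpha> \<beta>) =
    ereal (((1 - \<beta>) * ln (\<beta> - 1) + \<beta> * ln \<beta>) / (- ln (\<alpha> - 1) + \<beta> * ln \<alpha>))"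
    using hausdorff_dim_digit_mean_set by (simp only: digit_entropy_def lyapunov_def)
qed

end
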